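(* Assume that $z:=\inf_i d_i >0$ and also that $q_i/k_i$ grows no faster than a power of $i$. Let $\rho_i := p_i/k_i$. (1) If $d_i = o(i \rho_i)$ (as $i\to\infty$), then $\mathcal{F}(x) \to \infty$ (as $x\to\infty$), and consequently there is an equilibrium for all $\alpha, r$. (2) If $i\rho_i = O(d_i)$ (as $i\to\infty$), then $\mathcal{F}(x)$ is bounded. Thus there exists $m> 0$ such that there exists an equilibrium for $\alpha/r < m$ and no equilibrium for $\alpha/r \geq m$. (3) Finally, if $i\rho_i = o(d_i)$ (as $i\to\infty$), then $\mathcal{F}(x)$ is bounded and $\mathcal{F}(x) \to 0$ (as $x\to\infty$). In this case there exists $m> 0$ such that there exists an equilibrium for $\alpha/r \le m$ and no equilibrium for $\alpha/r > m$.
   Context: $(k_i)_{i\ge0}$, $(p_i)_{i\ge0}$, $(q_i)_{i\ge0}$ are sequences of rates ($k_i>0$, $p_i\ge0$, $q_i\ge0$), with $k_i$ and $p_i$ non-increasing in $i$. Set $d_i := (p_i+q_i)/k_i$. The parameters $\alpha>0$ and $r>0$ are constants. For $x\ge 0$ define $$\mathcal{F}(x) := \frac{x}{x+d_0} + \frac{1}{x+d_0}\sum_{i=1}^\infty \left( x - i \frac{q_i}{k_i} \right)\prod_{j=1}^i \frac{x}{x+d_j}.$$ An equilibrium for given $\alpha, r$ means a solution $x\ge 0$ of $$\frac{\alpha}{r}=\mathcal{F}(x).$$ This is the equation for the equilibrium quartz concentration $x$ of the system $\dot M_0 = r - k_0xM_0-(p_0+q_0)M_0$, $\dot M_i = k_{i-1}xM_{i-1}-k_ixM_i-(p_i+q_i)M_i$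 ($i\ge1$), $\dot x = \alpha - x\sum_{i\ge 0} k_iM_i+\sum_{i\ge 0} i q_i M_i$, where at equilibrium $M_i = \dfrac{r x^i}{k_i\prod_{j=0}^i(x+d_j)}$.
   Formalization: The claims that m exists in (2) and (3) assume p_i > 0 for some i ≥ 1 (otherwise F is identically 0). In (2), "< m / ≥ m" is stated only if F has no maximum on x ≥ 0; if F has one, it reads "≤ m / > m", since α/r = m then has an equilibrium. *)

theory Defs
  imports "HOL-Analysis.Analysis" "HOL-Library.Landau_Symbols"
begin

definition rho :: "(nat \<Rightarrow> real) \<Rightarrow> (nat \<Rightarrow> real) \<Rightarrow> nat \<Rightarrow> real" where
  "rho k p i = p i / k i"

definition d :: "(nat \<Rightarrow> real) \<Rightarrow> (nat \<Rightarrow> real) \<Rightarrow> (nat \<Rightarrow> real) \<Rightarrow> nat \<Rightarrow> real" where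
  "d k p q i = (p i + q i) / k i"

(* The series starts at index 1, hence Suc i. It converges absolutely for every x \<ge> 0 when
   the d i are bounded away from 0 and q i / k i has polynomial growth. *)
definition F :: "(nat \<Rightarrow> real) \<Rightarrow> (nat \<Rightarrow> real) \<Rightarrow> (nat \<Rightarrow> real) \<Rightarrow> real \<Rightarrow> real" where
  "F k p q x =
     x / (x + d k p q 0) +
     1 / (x + d k p q 0) *
       (\<Sum>i. (x - real (Suc i) * (q (Suc i) / k (Suc i))) *
             (\<Prod>j=1..Suc i. x / (x + d k p q j)))"

definition has_equilibrium ::
  "(nat \<Rightarrow> real) \<Rightarrow> (nat \<Rightarrow> real) \<Rightarrow> (nat \<Rightarrow> real) \<Rightarrow> real \<Rightarrow> real \<Rightarrow> bool" where
  "has_equilibrium k p q \<alpha> r \<longleftrightarrow> (\<exists>x\<ge>0. \<alpha> / r = F k p q x)"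

(* Whether the supremum of F over x \<ge> 0 is attained decides whether the threshold value of \<alpha> / r
   itself admits an equilibrium. Both cases occur when i * rho i is of exact order d i:
   with k = p = 1, q 0 = 0 and q i = i - 1 for i \<ge> 1, F x = x / (x + 1) does not attain it;
   changing q i to 0 for i \<le> 10 gives F 2 > 1 while F still tends to 1. *)
definition attains_max :: "(real \<Rightarrow> real) \<Rightarrow> bool" where
  "attains_max f \<longleftrightarrow> (\<exists>x0\<ge>0. \<forall>x\<ge>0. f x \<le> f x0)"

end

theory Submission imports Defs "HOL-Real_Asymp.Real_Asymp" begin

text \<open>
  Fix \<open>x > 0\<close> and follow one unit of the population \<open>M\<close>. In state \<open>i\<close>, where it carries \<open>i\<close> units
  of \<open>x\<close>, it loads one more unit at rate \<open>k i * x\<close> and leaves at rate \<open>p i + q i\<close>. Hence it moves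
  on to state \<open>i + 1\<close> with probability \<open>x / (x + d i)\<close>, so it reaches state \<open>n\<close> with probability
  \<open>S n = (\<Prod>j<n. x / (x + d j))\<close> and leaves from state \<open>i\<close> with probability
  \<open>w i = S i - S (i + 1)\<close>. Leaving through the \<open>q\<close> channel returns the load to the medium, leaving
  through the \<open>p\<close> channel removes it, so an exit from state \<open>i\<close> removes \<open>h i = i * rho i / d i\<close> units
  on average. At equilibrium the supply \<open>\<alpha>\<close> balances \<open>r\<close> times the mean load removed per unit of
  \<open>M\<close>, which suggests the identity behind the theorem:

  \<open>F x = (\<Sum>i. w i * h i)\<close>.

  It follows from the definition of \<open>F\<close> by summation by parts (\<open>F_sums_mean_removed\<close>). Since \<open>d\<close> is
  bounded below by \<open>z > 0\<close>, \<open>S n\<close> decays geometrically, so the \<open>w i\<close> sum to 1 and \<open>F x\<close> is an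
  average of the \<open>h i\<close>. As \<open>x\<close> grows, every \<open>S n\<close> tends to 1, so the whole mass of \<open>w\<close> escapes to
  infinity and \<open>F\<close> inherits the asymptotic behaviour of \<open>h\<close>: if \<open>h\<close> tends to infinity, is bounded, or tends
  to 0, then \<open>F\<close> does the same (\<open>F_at_top\<close>, \<open>bounded_F\<close>, \<open>F_tendsto_0\<close>).

  Existence and thresholds come from the intermediate value theorem. The series for \<open>F\<close> converges
  uniformly on bounded intervals, so \<open>F\<close> is continuous on the half-line (\<open>continuous_on_F\<close>), and
  \<open>F 0 = 0\<close>. If \<open>p i > 0\<close> for some \<open>i \<ge> 1\<close>, the identity also shows \<open>F x > 0\<close> for \<open>x > 0\<close>. In the
  bounded case the range is then a nontrivial interval starting at 0; the threshold \<open>m\<close> is its supremum,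
  and \<open>m\<close> itself is a value exactly when the maximum is attained. When \<open>F\<close> tends to 0 but takes a
  positive value, compactness provides the maximum.
\<close>

section \<open>Survival and exit probabilities\<close>

definition survival :: "(nat \<Rightarrow> real) \<Rightarrow> real \<Rightarrow> nat \<Rightarrow> real" where
  "survival c x n = (\<Prod>j<n. x / (x + c j))"

definition exit_prob :: "(nat \<Rightarrow> real) \<Rightarrow> real \<Rightarrow> nat \<Rightarrow> real" where
  "exit_prob c x n = survival c x n - survival c x (Suc n)"

text \<open>Each factor \<open>x / (x + c j)\<close> increases with \<open>x\<close> and decreases with \<open>c j\<close>, so it is at most
  \<open>R / (R + z)\<close>. The parameter \<open>R\<close> makes the bound uniform for \<open>x\<close> in \<open>{0..R}\<close>, as continuity needs.\<close>

lemma prod_ratio_le_power: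
  fixes c :: "nat \<Rightarrow> real"
  assumes "\<And>j. j \<in> A \<Longrightarrow> z \<le> c j" and z: "z > 0" and x: "0 \<le> x" "x \<le> R"
  shows "0 \<le> (\<Prod>j\<in>A. x / (x + c j))"
    and "(\<Prod>j\<in>A. x / (x + c j)) \<le> (R / (R + z)) ^ card A"
proof -
  have fac: "0 \<le> x / (x + c j) \<and> x / (x + c j) \<le> R / (R + z)" if "j \<in> A" for j
  proof -
    have c: "z \<le> c j" using assms(1) that by blast
    have "x * (R + z) \<le> R * (x + c j)"
      using mult_mono[OF x(2) c] x z by (simp add: algebra_simps)
    with c x z show ?thesis by (simp add: divide_simps)
  qed
  show "0 \<le> (\<Prod>j\<in>A. x / (x + c j))" using fac by (intro prod_nonneg) blast
  have "(\<Prod>j\<in>A. x / (x + c j)) \<le> (\<Prod>j\<in>A. R / (R + z))"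
    using fac by (intro prod_mono) blast
  then show "(\<Prod>j\<in>A. x / (x + c j)) \<le> (R / (R + z)) ^ card A" by simp
qed

lemma survival_bounds:
  assumes "\<And>j. z \<le> c j" "z > 0" "0 \<le> x"
  shows "0 \<le> survival c x n" "survival c x n \<le> (x / (x + z)) ^ n"
  using prod_ratio_le_power[of "{..<n}" z c x x] assms by (auto simp: survival_def)

lemma survival_0 [simp]: "survival c x 0 = 1"
  by (simp add: survival_def)

lemma exit_prob_eq:
  assumes "x > 0" "c n > 0"
  shows "exit_prob c x n = survival c x (Suc n) * c n / x"
proof -
  have ratio: "1 - x / (x + c n) = c n / (x + c n)" using assms by (simp add: field_simps)
  have "exit_prob c x n = survival c x n * (1 - x / (x + c n))"
    by (simp add: exit_prob_def survival_def right_diff_distrib)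
  then have "exit_prob c x n = survival c x n * (c n / (x + c n))"
    by (simp only: ratio)
  with assms show ?thesis by (simp add: survival_def)
qed

lemma exit_prob_nonneg:
  assumes "\<And>j. z \<le> c j" "z > 0" "x > 0"
  shows "0 \<le> exit_prob c x n"
proof -
  have "c n > 0" using assms(1)[of n] assms(2) by linarith
  with survival_bounds(1)[of z c x "Suc n"] assms show ?thesis
    by (simp add: exit_prob_eq)
qed

lemma times_survival_tendsto_0:
  assumes "\<And>j. z \<le> c j" "z > 0" "x > 0"
  shows "(\<lambda>n. real n * survival c x n) \<longlonglongrightarrow> 0"
proof (rule tendsto_sandwich[OF _ _ tendsto_const])
  show "(\<lambda>n. real n * (x / (x + z)) ^ n) \<longlonglongrightarrow> 0"
    using assms by (intro powser_times_n_limit_0) auto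
qed (use survival_bounds[of z c x] assms in \<open>auto intro!: always_eventually mult_left_mono\<close>)

lemma survival_tendsto_0:
  assumes "\<And>j. z \<le> c j" "z > 0" "x > 0"
  shows "survival c x \<longlonglongrightarrow> 0"
proof (rule tendsto_sandwich[OF _ _ tendsto_const])
  show "(\<lambda>n. (x / (x + z)) ^ n) \<longlonglongrightarrow> 0"
    using assms by (intro LIMSEQ_realpow_zero) auto
qed (use survival_bounds[of z c x] assms in \<open>auto intro!: always_eventually\<close>)

text \<open>The exit probabilities telescope; nothing is lost at infinity because the survival
  probabilities tend to 0.\<close>

lemma exit_prob_tail_sums:
  assumes "\<And>j. z \<le> c j" "z > 0" "x > 0"
  shows "(\<lambda>i. exit_prob c x (i + N)) sums survival c x N"
proof -
  have "(\<lambda>i. survival c x (i + N)) \<longlonglongrightarrow> 0"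
    using LIMSEQ_ignore_initial_segment[OF survival_tendsto_0[OF assms]] .
  from telescope_sums'[OF this] show ?thesis by (simp add: exit_prob_def)
qed

text \<open>For large \<open>x\<close> loading outpaces leaving in every fixed state, so each state is reached almost
  surely in the limit.\<close>

lemma survival_tendsto_1: "((\<lambda>x. survival c x n) \<longlongrightarrow> 1) at_top"
proof -
  have "((\<lambda>x. \<Prod>j<n. x / (x + c j)) \<longlongrightarrow> (\<Prod>j<n. 1)) at_top"
    by (intro tendsto_prod) real_asymp
  then show ?thesis by (simp add: survival_def)
qed

lemma summable_power_times_geometric:
  fixes t :: real
  assumes "0 < t" "t < 1"
  shows "summable (\<lambda>i. real i ^ n * t ^ i)"
proof (rule summable_comparison_test_bigo)
  show "summable (\<lambda>i. norm (((1 + t) / 2) ^ i))"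
    using assms by (simp add: power_abs summable_geometric)
  show "(\<lambda>i. real i ^ n * t ^ i) \<in> O(\<lambda>i. ((1 + t) / 2) ^ i)"
    using assms by real_asymp
qed

section \<open>Thresholds for the values of a continuous function\<close>

lemma value_below_attained:
  fixes f :: "real \<Rightarrow> real"
  assumes "continuous_on {0..} f" "f 0 = 0" "0 \<le> y" "0 \<le> a" "a \<le> f y"
  shows "\<exists>x\<ge>0. a = f x"
proof -
  have "continuous_on {0..y} f" using assms(1) by (rule continuous_on_subset) auto
  with IVT'[of f 0 a y] assms show ?thesis by auto
qed

text \<open>The threshold is the supremum: every smaller value lies below some \<open>f x\<close> and is reached by the
  intermediate value theorem, whereas reaching the supremum would make it a maximum.\<close>

lemma threshold_not_attained:
  fixes f :: "real \<Rightarrow> real"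
  assumes cont: "continuous_on {0..} f" and f0: "f 0 = 0" and bdd: "bounded (f ` {0..})"
    and pos: "y \<ge> 0" "f y > 0" and nmax: "\<not> attains_max f"
  shows "\<exists>m>0. \<forall>a>0. (a < m \<longrightarrow> (\<exists>x\<ge>0. a = f x)) \<and> (a \<ge> m \<longrightarrow> \<not> (\<exists>x\<ge>0. a = f x))"
proof -
  define m where "m = Sup (f ` {0..})"
  have le: "f x \<le> m" if "x \<ge> 0" for x
    unfolding m_def using that bounded_imp_bdd_above[OF bdd] by (intro cSup_upper) auto
  have below: "\<exists>x\<ge>0. a = f x" if a: "0 < a" "a < m" for a
  proof -
    obtain x where "x \<ge> 0" "a < f x"
      using less_cSupD[of "f ` {0..}" a] a(2) unfolding m_def by auto
    then show ?thesis using value_below_attained[OF cont f0, of x a] a(1) by simp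
  qed
  have above: "\<not> (\<exists>x\<ge>0. a = f x)" if "a \<ge> m" for a
  proof
    assume "\<exists>x\<ge>0. a = f x"
    then obtain x where x: "x \<ge> 0" "a = f x" by blast
    with that le have "\<forall>y\<ge>0. f y \<le> f x" by (metis order_trans)
    with x(1) nmax show False unfolding attains_max_def by blast
  qed
  have "m > 0" using le[OF pos(1)] pos(2) by linarith
  with below above show ?thesis by blast
qed

lemma threshold_attained:
  fixes f :: "real \<Rightarrow> real"
  assumes cont: "continuous_on {0..} f" and f0: "f 0 = 0"
    and pos: "y \<ge> 0" "f y > 0" and max: "attains_max f"
  shows "\<exists>m>0. \<forall>a>0. (a \<le> m \<longrightarrow> (\<exists>x\<ge>0. a = f x)) \<and> (a > m \<longrightarrow> \<not> (\<exists>x\<ge>0. a = f x))"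
proof -
  obtain x0 where x0: "x0 \<ge> 0" "\<And>x. x \<ge> 0 \<Longrightarrow> f x \<le> f x0"
    using max unfolding attains_max_def by blast
  have "\<exists>x\<ge>0. a = f x" if "0 < a" "a \<le> f x0" for a
    using value_below_attained[OF cont f0 x0(1), of a] that by simp
  moreover have "\<not> (\<exists>x\<ge>0. a = f x)" if "f x0 < a" for a
    using x0(2) that by force
  moreover have "f x0 > 0" using x0(2)[OF pos(1)] pos(2) by linarith
  ultimately show ?thesis by blast
qed

text \<open>Beyond some \<open>R\<close> the function stays below the given positive value \<open>f y\<close>, so its maximum over the
  compact interval \<open>{0..max R y}\<close> is a global one.\<close>

lemma attains_max_if_vanishing:
  fixes f :: "real \<Rightarrow> real"
  assumes cont: "continuous_on {0..} f" and lim: "(f \<longlongrightarrow> 0) at_top"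
    and pos: "y \<ge> 0" "f y > 0"
  shows "attains_max f"
proof -
  obtain R where R: "\<And>x. x \<ge> R \<Longrightarrow> f x < f y"
    using order_tendstoD(2)[OF lim pos(2)] unfolding eventually_at_top_linorder by blast
  have "continuous_on {0..max R y} f" using cont by (rule continuous_on_subset) auto
  then obtain x0 where x0: "x0 \<in> {0..max R y}" "\<And>x. x \<in> {0..max R y} \<Longrightarrow> f x \<le> f x0"
    using continuous_attains_sup[of "{0..max R y}" f] pos(1) by force
  have "f x \<le> f x0" if "x \<ge> 0" for x
  proof (cases "x \<le> max R y")
    case True
    then show ?thesis using x0(2) that by simp
  next
    case False
    then have "f x < f y" using R by simp
    also have "f y \<le> f x0" using x0(2)[of y] pos(1) by simp
    finally show ?thesis by simp
  qed
  then show ?thesis using x0(1) unfolding attains_max_def by auto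
qed

section \<open>Convergence and continuity of the equilibrium function\<close>

locale quartz_rates =
  fixes k p q :: "nat \<Rightarrow> real" and z :: real
  assumes k_pos: "\<And>i. k i > 0"
    and p_nonneg: "\<And>i. p i \<ge> 0"
    and q_nonneg: "\<And>i. q i \<ge> 0"
    and z_pos: "z > 0"
    and z_le_d: "\<And>i. z \<le> d k p q i"
    and q_growth: "\<exists>n::nat. (\<lambda>i. q i / k i) \<in> O(\<lambda>i. real i ^ n)"
begin

lemma d_pos: "d k p q i > 0"
  using z_pos z_le_d[of i] by linarith

lemma d_split: "d k p q i = rho k p i + q i / k i"
  by (simp add: d_def rho_def add_divide_distrib)

lemma rho_nonneg: "rho k p i \<ge> 0"
  using k_pos[of i] p_nonneg[of i] by (simp add: rho_def)

definition term_of_F :: "nat \<Rightarrow> real \<Rightarrow> real" where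
  "term_of_F i x = (x - real (Suc i) * (q (Suc i) / k (Suc i))) *
     (\<Prod>j=1..Suc i. x / (x + d k p q j))"

text \<open>This is where the growth hypothesis on \<open>q i / k i\<close> enters: a power loses against \<open>t ^ i\<close>.\<close>

lemma summable_majorant:
  assumes "0 < t" "t < 1"
  shows "summable (\<lambda>i. (R + real (Suc i) * (q (Suc i) / k (Suc i))) * t ^ Suc i)"
proof -
  obtain n where n: "(\<lambda>i. q i / k i) \<in> O(\<lambda>i. real i ^ n)" using q_growth by blast
  have "(\<lambda>i. real i * t ^ i * (q i / k i)) \<in> O(\<lambda>i. real i * t ^ i * real i ^ n)"
    using n by (intro landau_o.big.mult) auto
  moreover have "summable (\<lambda>i. norm (real i * t ^ i * real i ^ n))"
    using summable_power_times_geometric[OF assms, of "Suc n"] assms(1)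
    by (simp add: mult_ac abs_mult)
  ultimately have "summable (\<lambda>i. real i * t ^ i * (q i / k i))"
    by (rule summable_comparison_test_bigo[rotated])
  moreover have "summable (\<lambda>i. R * t ^ i)"
    using assms by (intro summable_mult summable_geometric) auto
  ultimately have "summable (\<lambda>i. R * t ^ i + real i * t ^ i * (q i / k i))"
    by (rule summable_add[rotated])
  then have "summable (\<lambda>i. (R + real i * (q i / k i)) * t ^ i)"
    by (simp add: algebra_simps)
  then show ?thesis by (subst (asm) summable_Suc_iff[symmetric])
qed

text \<open>A bound independent of \<open>x\<close> in \<open>{0..R}\<close>: it is the majorant of the Weierstrass test.\<close>

lemma term_of_F_bound:
  assumes "0 \<le> x" "x \<le> R"
  shows "norm (term_of_F i x)
    \<le> (R + real (Suc i) * (q (Suc i) / k (Suc i))) * (R / (R + z)) ^ Suc i"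
proof -
  have pr: "0 \<le> (\<Prod>j=1..Suc i. x / (x + d k p q j))"
    "(\<Prod>j=1..Suc i. x / (x + d k p q j)) \<le> (R / (R + z)) ^ Suc i"
    using prod_ratio_le_power[of "{1..Suc i}" z "d k p q" x R] z_pos z_le_d assms by auto
  have s: "0 \<le> real (Suc i) * (q (Suc i) / k (Suc i))"
    using k_pos[of "Suc i"] q_nonneg[of "Suc i"] by simp
  have "\<bar>x - real (Suc i) * (q (Suc i) / k (Suc i))\<bar> \<le> R + real (Suc i) * (q (Suc i) / k (Suc i))"
    using s assms by linarith
  then show ?thesis
    unfolding term_of_F_def real_norm_def abs_mult abs_of_nonneg[OF pr(1)]
    using pr s assms by (intro mult_mono) auto
qed

lemma summable_term_of_F:
  assumes "x > 0"
  shows "summable (\<lambda>i. term_of_F i x)"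
proof (rule summable_comparison_test')
  show "summable (\<lambda>i. (x + real (Suc i) * (q (Suc i) / k (Suc i))) * (x / (x + z)) ^ Suc i)"
    using assms z_pos by (intro summable_majorant) auto
  show "norm (term_of_F i x)
    \<le> (x + real (Suc i) * (q (Suc i) / k (Suc i))) * (x / (x + z)) ^ Suc i" for i
    using assms by (intro term_of_F_bound) auto
qed

lemma F_eq_term_of_F:
  "F k p q x = x / (x + d k p q 0) + 1 / (x + d k p q 0) * (\<Sum>i. term_of_F i x)"
  by (simp add: F_def term_of_F_def)

lemma continuous_on_F: "continuous_on {0..} (F k p q)"
proof -
  have "continuous_on {0..R} (F k p q)" if R: "R > 0" for R
  proof -
    have nz: "x + d k p q j \<noteq> 0" if "x \<in> {0..R}" for x j
      using d_pos[of j] that by auto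
    have "uniform_limit {0..R} (\<lambda>n x. \<Sum>i<n. term_of_F i x) (\<lambda>x. \<Sum>i. term_of_F i x) sequentially"
    proof (rule Weierstrass_m_test)
      show "summable (\<lambda>i. (R + real (Suc i) * (q (Suc i) / k (Suc i))) * (R / (R + z)) ^ Suc i)"
        using R z_pos by (intro summable_majorant) auto
    qed (rule term_of_F_bound; simp)
    moreover have "continuous_on {0..R} (\<lambda>x. \<Sum>i<n. term_of_F i x)" for n
      unfolding term_of_F_def using nz by (intro continuous_intros) auto
    ultimately have "continuous_on {0..R} (\<lambda>x. \<Sum>i. term_of_F i x)"
      by (intro uniform_limit_theorem[OF always_eventually]) auto
    then show ?thesis
      unfolding F_eq_term_of_F[abs_def] using nz by (intro continuous_intros) auto
  qed
  note on_segment = this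
  \<comment> \<open>\<open>R = x + 1\<close> makes \<open>{0..R}\<close> a neighbourhood of \<open>x\<close> within the half-line.\<close>
  have "continuous (at x within {0..}) (F k p q)" if x: "x \<in> {0..}" for x
  proof -
    have "continuous (at x within {0..x + 1}) (F k p q)"
      using on_segment[of "x + 1"] x by (simp add: continuous_on_eq_continuous_within)
    moreover have "at x within {0..x + 1} = at x within {0..}"
      using x by (intro at_within_nhd[of x "{..<x + 1}"]) auto
    ultimately show ?thesis by simp
  qed
  then show ?thesis by (simp add: continuous_on_eq_continuous_within)
qed

lemma F_0: "F k p q 0 = 0"
  by (simp add: F_def)

section \<open>The equilibrium function as a mean removed load\<close>

text \<open>
  The mean load removed by an exit from state \<open>i\<close>: the exit uses the \<open>p\<close> channel with probability
  \<open>rho i / d i\<close> and then takes \<open>i\<close> units away.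
\<close>

definition removed :: "nat \<Rightarrow> real" where
  "removed i = real i * rho k p i / d k p q i"

lemma removed_nonneg: "removed i \<ge> 0"
  using rho_nonneg[of i] d_pos[of i] by (simp add: removed_def)

lemma exit_nonneg: "x > 0 \<Longrightarrow> exit_prob (d k p q) x i \<ge> 0"
  using z_le_d z_pos by (rule exit_prob_nonneg)

text \<open>
  With \<open>S\<close> the survival probability, \<open>\<sigma> i = q i / k i\<close> and \<open>w i = S i - S (i + 1)\<close>, the \<open>i\<close>-th
  summand of \<open>F x\<close> is \<open>a i = S (i + 1) - i * \<sigma> i * S (i + 1) / x\<close>. Since \<open>w i = S (i + 1) * d i / x\<close>
  and \<open>d i - \<sigma> i = rho i\<close>, adding the difference \<open>i * S i - (i + 1) * S (i + 1)\<close> turns it into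
  \<open>i * w i - i * \<sigma> i * S (i + 1) / x = w i * removed i\<close>. These differences telescope to 0 because
  \<open>i * S i\<close> tends to 0.
\<close>

lemma F_sums_mean_removed:
  assumes x: "x > 0"
  shows "(\<lambda>i. exit_prob (d k p q) x i * removed i) sums F k p q x"
proof -
  define S where "S = survival (d k p q) x"
  define a where "a i = S (Suc i) - real i * (q i / k i) * S (Suc i) / x" for i
  have S_Suc: "S (Suc n) = x / (x + d k p q 0) * (\<Prod>j=1..n. x / (x + d k p q j))" for n
    unfolding S_def survival_def
    by (subst prod.lessThan_Suc_shift)
       (simp add: prod.atLeast1_atMost_eq)
  have nz: "x + d k p q 0 > 0" using d_pos[of 0] x by simp
  have "a (Suc i) = 1 / (x + d k p q 0) * term_of_F i x" for i
  proof -
    define P where "P = (\<Prod>j=1..Suc i. x / (x + d k p q j))"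
    define u where "u = real (Suc i) * (q (Suc i) / k (Suc i))"
    define D where "D = x + d k p q 0"
    have "D > 0" using nz by (simp add: D_def)
    then show ?thesis
      unfolding a_def term_of_F_def S_Suc P_def[symmetric] u_def[symmetric] D_def[symmetric]
      using x by (simp add: field_simps)
  qed
  moreover have "(\<lambda>i. 1 / (x + d k p q 0) * term_of_F i x) sums
      (1 / (x + d k p q 0) * (\<Sum>i. term_of_F i x))"
    using summable_term_of_F[OF x] by (intro sums_mult summable_sums)
  ultimately have "(\<lambda>i. a (Suc i)) sums (1 / (x + d k p q 0) * (\<Sum>i. term_of_F i x))"
    by simp
  moreover have "a 0 = x / (x + d k p q 0)" by (simp add: a_def S_Suc)
  ultimately have "a sums F k p q x"
    by (subst (asm) sums_Suc_iff) (simp add: F_eq_term_of_F add.commute)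
  moreover have "(\<lambda>i. real i * S i) \<longlonglongrightarrow> 0"
    unfolding S_def using times_survival_tendsto_0[of z "d k p q" x] z_le_d z_pos x by simp
  note telescope_sums'[OF this]
  ultimately have "(\<lambda>i. a i + (real i * S i - real (Suc i) * S (Suc i))) sums (F k p q x + 0)"
    by (intro sums_add) simp_all
  moreover have "a i + (real i * S i - real (Suc i) * S (Suc i)) = exit_prob (d k p q) x i * removed i"
    for i
  proof -
    have w: "S i - S (Suc i) = S (Suc i) * d k p q i / x"
      using exit_prob_eq[of x "d k p q" i] x d_pos[of i] by (simp add: exit_prob_def S_def)
    have "a i + (real i * S i - real (Suc i) * S (Suc i))
        = real i * (S i - S (Suc i)) - real i * (q i / k i) * S (Suc i) / x"
      by (simp add: a_def algebra_simps)
    also have "\<dots> = real i * rho k p i * S (Suc i) / x"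
      unfolding w d_split by (simp add: algebra_simps add_divide_distrib)
    also have "\<dots> = S (Suc i) * d k p q i / x * removed i"
      using d_pos[of i] by (simp add: removed_def)
    finally show ?thesis using w by (simp add: exit_prob_def S_def)
  qed
  ultimately show ?thesis by simp
qed

lemma F_nonneg: "x \<ge> 0 \<Longrightarrow> F k p q x \<ge> 0"
proof (cases "x = 0")
  case False
  assume "x \<ge> 0"
  with False show ?thesis
    using sums_le[OF _ sums_zero F_sums_mean_removed[of x]] exit_nonneg removed_nonneg by simp
qed (simp add: F_0)

lemma F_pos:
  assumes x: "x > 0" and i: "i \<ge> 1" "p i > 0"
  shows "F k p q x > 0"
proof -
  let ?t = "\<lambda>i. exit_prob (d k p q) x i * removed i"
  have "0 < survival (d k p q) x (Suc i)"
    unfolding survival_def using x d_pos by (intro prod_pos) (auto simp: add_pos_pos)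
  then have "0 < ?t i"
    using x i d_pos[of i] k_pos[of i] by (simp add: exit_prob_eq removed_def rho_def)
  then have "0 < suminf ?t"
    using x exit_nonneg removed_nonneg sums_summable[OF F_sums_mean_removed[OF x]]
    by (intro suminf_pos2[of _ i]) auto
  then show ?thesis using F_sums_mean_removed[OF x] by (simp add: sums_iff)
qed

section \<open>Behaviour for large concentrations\<close>

lemma F_ge_tail:
  assumes x: "x > 0" and C: "\<And>i. i \<ge> N \<Longrightarrow> C \<le> removed i"
  shows "C * survival (d k p q) x N \<le> F k p q x"
proof -
  let ?w = "exit_prob (d k p q) x"
  let ?t = "\<lambda>i. ?w i * removed i"
  have tail: "(\<lambda>i. C * ?w (i + N)) sums (C * survival (d k p q) x N)"
    using exit_prob_tail_sums[of z "d k p q" x N] z_le_d z_pos x by (intro sums_mult) auto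
  have "(\<lambda>i. ?t (i + N)) sums (F k p q x - (\<Sum>i<N. ?t i))"
    using F_sums_mean_removed[OF x] by (rule sums_split_initial_segment)
  then have "C * survival (d k p q) x N \<le> F k p q x - (\<Sum>i<N. ?t i)"
    using C exit_nonneg[OF x]
    by (intro sums_le[OF _ tail]) (auto simp: mult.commute intro!: mult_right_mono)
  moreover have "0 \<le> (\<Sum>i<N. ?t i)"
    using exit_nonneg[OF x] removed_nonneg by (intro sum_nonneg) simp
  ultimately show ?thesis by linarith
qed

text \<open>Exits before state \<open>N\<close> have total probability \<open>1 - S N\<close> (\<open>S\<close> the survival
  probability) and remove at most \<open>B\<close> each; the remaining
  mass \<open>S N\<close> sits where \<open>removed\<close> is at most \<open>e\<close>. Taking \<open>e = B\<close> gives boundedness, and letting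
  \<open>x\<close> tend to infinity removes the first summand.\<close>

lemma F_le_split:
  assumes x: "x > 0" and B: "\<And>i. removed i \<le> B" and e: "\<And>i. i \<ge> N \<Longrightarrow> removed i \<le> e"
  shows "F k p q x \<le> B * (1 - survival (d k p q) x N) + e * survival (d k p q) x N"
proof -
  let ?w = "exit_prob (d k p q) x"
  let ?t = "\<lambda>i. ?w i * removed i"
  have tail: "(\<lambda>i. e * ?w (i + N)) sums (e * survival (d k p q) x N)"
    using exit_prob_tail_sums[of z "d k p q" x N] z_le_d z_pos x by (intro sums_mult) auto
  have "(\<lambda>i. ?t (i + N)) sums (F k p q x - (\<Sum>i<N. ?t i))"
    using F_sums_mean_removed[OF x] by (rule sums_split_initial_segment)
  then have "F k p q x - (\<Sum>i<N. ?t i) \<le> e * survival (d k p q) x N"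
    using e exit_nonneg[OF x]
    by (intro sums_le[OF _ _ tail]) (auto simp: mult.commute intro!: mult_right_mono)
  moreover have "(\<Sum>i<N. ?t i) \<le> (\<Sum>i<N. ?w i * B)"
    using exit_nonneg[OF x] B by (intro sum_mono mult_left_mono) auto
  moreover have "(\<Sum>i<N. ?w i * B) = B * (1 - survival (d k p q) x N)"
    using sum_lessThan_telescope'[of "survival (d k p q) x" N]
    by (simp add: exit_prob_def sum_distrib_right[symmetric])
  ultimately show ?thesis by linarith
qed

lemma F_at_top:
  assumes "d k p q \<in> o(\<lambda>i. real i * rho k p i)"
  shows "filterlim (F k p q) at_top at_top"
  unfolding filterlim_at_top_gt[of _ _ "0::real"]
proof (intro allI impI)
  fix C :: real
  assume C: "C > 0"
  have "eventually (\<lambda>i. norm (d k p q i) \<le> 1 / (2 * C) * norm (real i * rho k p i)) sequentially"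
    using landau_o.smallD[OF assms, of "1 / (2 * C)"] C by simp
  then obtain N where N: "\<And>i. i \<ge> N \<Longrightarrow> d k p q i \<le> 1 / (2 * C) * (real i * rho k p i)"
    using d_pos rho_nonneg
    unfolding eventually_sequentially real_norm_def abs_mult abs_of_pos[OF d_pos]
      abs_of_nonneg[OF rho_nonneg] abs_of_nat by blast
  \<comment> \<open>The factor 2 compensates for a tail that is only known to carry more than half of the mass.\<close>
  have removed: "2 * C \<le> removed i" if "i \<ge> N" for i
    using N[OF that] d_pos[of i] C by (simp add: removed_def field_simps)
  have "eventually (\<lambda>x. survival (d k p q) x N > 1 / 2) at_top"
    using survival_tendsto_1 by (rule order_tendstoD) simp
  then show "eventually (\<lambda>x. C \<le> F k p q x) at_top"
    using eventually_gt_at_top[of "0::real"]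
  proof eventually_elim
    case (elim x)
    have "C \<le> 2 * C * survival (d k p q) x N" using elim(1) C by simp
    also have "\<dots> \<le> F k p q x" using F_ge_tail[OF elim(2) removed] .
    finally show ?case .
  qed
qed

text \<open>The asymptotic hypothesis gives a bound for all large indices only; as \<open>d\<close> never vanishes, the
  finitely many remaining values are harmless.\<close>

lemma removed_bounded:
  assumes "(\<lambda>i. real i * rho k p i) \<in> O(d k p q)"
  obtains B where "\<And>i. removed i \<le> B"
proof -
  obtain C where "eventually (\<lambda>i. norm (real i * rho k p i) \<le> C * norm (d k p q i)) sequentially"
    using assms by (elim landau_o.bigE)
  then have "eventually (\<lambda>i. norm (removed i) \<le> C) sequentially"
    by eventually_elim (simp add: removed_def abs_of_pos[OF d_pos] pos_divide_le_eq[OF d_pos])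
  then have "Bseq removed" by (rule BfunI)
  then obtain B where "\<And>i. norm (removed i) \<le> B" by (auto simp: Bseq_def)
  then show ?thesis by (intro that[of B]) (simp add: abs_le_iff)
qed

lemma bounded_F:
  assumes "(\<lambda>i. real i * rho k p i) \<in> O(d k p q)"
  shows "bounded (F k p q ` {0..})"
proof -
  obtain B where B: "\<And>i. removed i \<le> B" using removed_bounded[OF assms] by blast
  have "norm (F k p q x) \<le> B" if "x \<ge> 0" for x
  proof (cases "x = 0")
    case True
    then show ?thesis using B[of 0] removed_nonneg[of 0] by (simp add: F_0)
  next
    case False
    with that show ?thesis using F_le_split[of x B 0 B] B F_nonneg[of x] by simp
  qed
  then show ?thesis by (auto simp: bounded_iff)
qed

lemma F_tendsto_0:
  assumes o: "(\<lambda>i. real i * rho k p i) \<in> o(d k p q)"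
  shows "(F k p q \<longlongrightarrow> 0) at_top"
proof (rule tendstoI)
  fix e :: real
  assume e: "e > 0"
  obtain B where B: "\<And>i. removed i \<le> B"
    using removed_bounded[OF landau_o.small_imp_big[OF o]] by blast
  have "removed \<longlonglongrightarrow> 0"
    using smalloD_tendsto[OF o] by (simp add: removed_def[abs_def])
  then have "eventually (\<lambda>i. removed i < e / 2) sequentially"
    using e by (intro order_tendstoD(2)) auto
  then obtain N where N: "\<And>i. i \<ge> N \<Longrightarrow> removed i \<le> e / 2"
    unfolding eventually_sequentially by (meson less_imp_le)
  have "((\<lambda>x. B * (1 - survival (d k p q) x N) + e / 2 * survival (d k p q) x N)
      \<longlongrightarrow> B * (1 - 1) + e / 2 * 1) at_top"
    by (intro tendsto_intros survival_tendsto_1)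
  from order_tendstoD(2)[OF this, of e]
  have "eventually (\<lambda>x. B * (1 - survival (d k p q) x N)
      + e / 2 * survival (d k p q) x N < e) at_top"
    using e by simp
  then show "eventually (\<lambda>x. dist (F k p q x) 0 < e) at_top"
    using eventually_gt_at_top[of "0::real"]
  proof eventually_elim
    case (elim x)
    have "F k p q x < e"
      using F_le_split[where N = N, OF elim(2) B N] elim(1) by linarith
    then show ?case using F_nonneg[of x] elim(2) by simp
  qed
qed

end

section \<open>Equilibria\<close>

theorem theorem4:
  fixes k p q :: "nat \<Rightarrow> real"
  assumes k_pos: "\<And>i. k i > 0"
    and p_nonneg: "\<And>i. p i \<ge> 0"
    and q_nonneg: "\<And>i. q i \<ge> 0"
    and k_noninc: "antimono k"
    and p_noninc: "antimono p"
    and z_pos: "(INF i. d k p q i) > 0"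
    and q_growth: "\<exists>n::nat. (\<lambda>i. q i / k i) \<in> O(\<lambda>i. real i ^ n)"
  shows
    "(d k p q \<in> o(\<lambda>i. real i * rho k p i) \<longrightarrow>
        filterlim (F k p q) at_top at_top \<and>
        (\<forall>\<alpha>>0. \<forall>r>0. has_equilibrium k p q \<alpha> r))
     \<and>
     ((\<lambda>i. real i * rho k p i) \<in> O(d k p q) \<longrightarrow>
        bounded (F k p q ` {0..}) \<and>
        ((\<exists>i\<ge>1. p i > 0) \<longrightarrow>
          (\<not> attains_max (F k p q) \<longrightarrow>
            (\<exists>m>0. (\<forall>\<alpha>>0. \<forall>r>0. \<alpha> / r < m \<longrightarrow> has_equilibrium k p q \<alpha> r) \<and>
                   (\<forall>\<alpha>>0. \<forall>r>0. \<alpha> / r \<ge> m \<longrightarrow> \<not> has_equilibrium k p q \<alpha> r))) \<and>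
          (attains_max (F k p q) \<longrightarrow>
            (\<exists>m>0. (\<forall>\<alpha>>0. \<forall>r>0. \<alpha> / r \<le> m \<longrightarrow> has_equilibrium k p q \<alpha> r) \<and>
                   (\<forall>\<alpha>>0. \<forall>r>0. \<alpha> / r > m \<longrightarrow> \<not> has_equilibrium k p q \<alpha> r)))))
     \<and>
     ((\<lambda>i. real i * rho k p i) \<in> o(d k p q) \<longrightarrow>
        bounded (F k p q ` {0..}) \<and>
        (F k p q \<longlongrightarrow> 0) at_top \<and>
        ((\<exists>i\<ge>1. p i > 0) \<longrightarrow>
          (\<exists>m>0. (\<forall>\<alpha>>0. \<forall>r>0. \<alpha> / r \<le> m \<longrightarrow> has_equilibrium k p q \<alpha> r) \<and>
                 (\<forall>\<alpha>>0. \<forall>r>0. \<alpha> / r > m \<longrightarrow> \<not> has_equilibrium k p q \<alpha> r))))"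
proof -
  have "bdd_below (range (d k p q))"
    using k_pos p_nonneg q_nonneg
    by (intro bdd_belowI[of _ 0]) (auto simp: d_def less_imp_le)
  then have "(INF i. d k p q i) \<le> d k p q i" for i by (rule cINF_lower) simp
  then interpret quartz_rates k p q "INF i. d k p q i"
    using k_pos p_nonneg q_nonneg z_pos q_growth by unfold_locales auto
  have equilibrium_iff: "has_equilibrium k p q \<alpha> r \<longleftrightarrow> (\<exists>x\<ge>0. \<alpha> / r = F k p q x)" for \<alpha> r
    by (simp add: has_equilibrium_def)
  have case1: "has_equilibrium k p q \<alpha> r"
    if "filterlim (F k p q) at_top at_top" "\<alpha> > 0" "r > 0" for \<alpha> r
  proof -
    have "eventually (\<lambda>x. \<alpha> / r \<le> F k p q x \<and> 0 \<le> x) at_top"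
      using that(1) eventually_ge_at_top[of "0::real"]
      by (auto simp: filterlim_at_top intro: eventually_conj)
    then obtain x where "\<alpha> / r \<le> F k p q x" "0 \<le> x"
      using eventually_happens by force
    then show ?thesis
      using value_below_attained[OF continuous_on_F F_0, of x "\<alpha> / r"] that(2,3)
      by (simp add: equilibrium_iff)
  qed
  have pos: "F k p q 1 > 0" if "\<exists>i\<ge>1. p i > 0"
    using that F_pos[of 1] by auto
  have attained: "\<exists>m>0. (\<forall>\<alpha>>0. \<forall>r>0. \<alpha> / r \<le> m \<longrightarrow> has_equilibrium k p q \<alpha> r) \<and>
      (\<forall>\<alpha>>0. \<forall>r>0. \<alpha> / r > m \<longrightarrow> \<not> has_equilibrium k p q \<alpha> r)"
    if p: "\<exists>i\<ge>1. p i > 0" and max: "attains_max (F k p q)"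
  proof -
    obtain m where "m > 0" "\<And>a. a > 0 \<Longrightarrow> (a \<le> m \<longrightarrow> (\<exists>x\<ge>0. a = F k p q x)) \<and>
        (a > m \<longrightarrow> \<not> (\<exists>x\<ge>0. a = F k p q x))"
      using threshold_attained[OF continuous_on_F F_0 _ pos[OF p] max] by auto
    then show ?thesis unfolding equilibrium_iff by (intro exI[of _ m]) simp
  qed
  have not_attained: "\<exists>m>0. (\<forall>\<alpha>>0. \<forall>r>0. \<alpha> / r < m \<longrightarrow> has_equilibrium k p q \<alpha> r) \<and>
      (\<forall>\<alpha>>0. \<forall>r>0. \<alpha> / r \<ge> m \<longrightarrow> \<not> has_equilibrium k p q \<alpha> r)"
    if p: "\<exists>i\<ge>1. p i > 0" and nmax: "\<not> attains_max (F k p q)"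
      and bdd: "bounded (F k p q ` {0..})"
  proof -
    obtain m where "m > 0" "\<And>a. a > 0 \<Longrightarrow> (a < m \<longrightarrow> (\<exists>x\<ge>0. a = F k p q x)) \<and>
        (a \<ge> m \<longrightarrow> \<not> (\<exists>x\<ge>0. a = F k p q x))"
      using threshold_not_attained[OF continuous_on_F F_0 bdd _ pos[OF p] nmax] by auto
    then show ?thesis unfolding equilibrium_iff by (intro exI[of _ m]) simp
  qed
  have vanishing: "attains_max (F k p q)"
    if "(F k p q \<longlongrightarrow> 0) at_top" "\<exists>i\<ge>1. p i > 0"
    using attains_max_if_vanishing[OF continuous_on_F that(1) _ pos[OF that(2)]] by simp
  have of_bigo: "bounded (F k p q ` {0..})" if "(\<lambda>i. real i * rho k p i) \<in> o(d k p q)"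
    using bounded_F[OF landau_o.small_imp_big[OF that]] .
  show ?thesis
    apply (intro conjI impI allI)
    subgoal by (rule F_at_top)
    subgoal by (rule case1[OF F_at_top])
    subgoal by (rule bounded_F)
    subgoal by (rule not_attained[OF _ _ bounded_F])
    subgoal by (rule attained)
    subgoal by (rule of_bigo)
    subgoal by (rule F_tendsto_0)
    subgoal by (rule attained[OF _ vanishing[OF F_tendsto_0]])
    done
qed

end
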